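(* Let $\mathbf{F}:\mathbb{R}^N\to\mathbb{R}^N$ be of class $C^r$ ($r\ge1$) near the origin and consider the system $\mathbf{x}\mapsto\mathbf{F}(\mathbf{x})$. Let $\mathbf{x}_0=0$ be a hyperbolic fixed point with $m$ multipliers inside the unit circle and $N-m$ multipliers outside the unit circle. Let the stable manifold be given by $Y=G(X)$, where $G:\mathbb{R}^m\to\mathbb{R}^{N-m}$ is of class $C^r$. Let $S(X_1,Y_1)=\{(X_n,Y_n)\}_{n\in\mathbb{N}}$ be an orbit of the system on the stable manifold, in the form $$X_{n+1}=\Lambda X_n+F_2(X_n,G(X_n)),\qquad Y_{n+1}=G(X_{n+1}),$$ with initial point $(X_1,Y_1)$, $Y_1=G(X_1)$. Then there exists $\rho>0$ such that for $\|(X_1,Y_1)\|<\rho$ we have $\dim_B S(X_1,Y_1)=0$.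
   Context: The multipliers of a fixed point are the eigenvalues of the Jacobi matrix there; the fixed point is hyperbolic if no multiplier has modulus $1$. Coordinates $(X,Y)\in\mathbb{R}^m\times\mathbb{R}^{N-m}$ are chosen so that the $X$-component of $\mathbf{F}$ is $\Lambda X+F_2(X,Y)$, where $\Lambda$ is the $m\times m$ matrix whose eigenvalues are the $m$ multipliers inside the unit circle, and $F_2$ contains the higher-order terms ($F_2$ is of class $C^r$ and $F_2$ and its first derivative vanish at the origin). The local stable manifold is the graph $Y=G(X)$ near the origin, with $G(0)=0$ and tangent at the origin to the generalized eigenspace of the multipliers inside the unit circle, so $DG(0)=0$. An orbit is identified with its set of points. Box dimension: for a bounded set $A\subset\mathbb{R}^N$ let $A_\varepsilon=\{y\in\mathbb{R}^N: d(y,A)<\varepsilon\}$ and let $|A_\varepsilon|$ be its Lebesgue measure. For $s\ge 0$ put $\mathcal{M}_*^s(A)=\liminf_{\varepsilon\to0}|A_\varepsilon|/\varepsilon^{N-s}$ and $\mathcal{M}^{*s}(A)=\limsup_{\varepsilon\to0}|A_\varepsilon|/\varepsilon^{N-s}$. The lower and upper box dimensions are $\underline{\dim}_B A=\inf\{s>0:\mathcal{M}_*^s(A)=0\}$ and $\overline{\dim}_B A=\inf\{s>0:\mathcal{M}^{*s}(A)=0\}$; if they coincide, the common value is denoted $\dim_B A$. The assertion $\dim_B A=d$ includes that both coincide. *)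

theory Defs
  imports "HOL-Analysis.Analysis" "HOL-Computational_Algebra.Polynomial"
begin

text \<open>
  The splitting \<open>\<real>\<^sup>N = \<real>\<^sup>m \<times> \<real>\<^sup>N\<^sup>-\<^sup>m\<close> is modelled inside \<open>real ^ 'n\<close> by a set \<open>I\<close> of coordinate
  indices with \<open>card I = m\<close>: the first factor consists of the vectors supported on \<open>I\<close>, the second
  one of the vectors supported on \<open>- I\<close>, and the point \<open>(X, Y)\<close> is \<open>X + Y\<close>. In contrast to a
  product of two Cartesian spaces, this also covers \<open>m = 0\<close> and \<open>m = N\<close>.
\<close>

definition coord_space :: "'n set \<Rightarrow> (real ^ 'n) set" where
  "coord_space I = {v. \<forall>i. i \<notin> I \<longrightarrow> v $ i = 0}"

definition coord_proj :: "'n set \<Rightarrow> real ^ 'n \<Rightarrow> real ^ 'n" where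
  "coord_proj I v = (\<chi> i. if i \<in> I then v $ i else 0)"


text \<open>Class \<open>C\<^sup>k\<close> on an open set; the partial derivatives are replaced by all directional ones.\<close>

fun Ck_on :: "nat \<Rightarrow> ('a::real_normed_vector \<Rightarrow> 'b::real_normed_vector) \<Rightarrow> 'a set \<Rightarrow> bool" where
  "Ck_on 0 f U \<longleftrightarrow> continuous_on U f"
| "Ck_on (Suc k) f U \<longleftrightarrow>
     (\<forall>x\<in>U. f differentiable (at x)) \<and> (\<forall>v. Ck_on k (\<lambda>x. frechet_derivative f (at x) v) U)"

definition Ck_near :: "nat \<Rightarrow> ('a::real_normed_vector \<Rightarrow> 'b::real_normed_vector) \<Rightarrow> 'a \<Rightarrow> bool" where
  "Ck_near k f x \<longleftrightarrow> (\<exists>U. open U \<and> x \<in> U \<and> Ck_on k f U)"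


text \<open>
  \<open>charpoly_on I A\<close> is the characteristic polynomial of the submatrix of \<open>A\<close> with rows and columns
  in \<open>I\<close>: outside this block the matrix below is the identity, so its determinant is that of
  \<open>t \<cdot> 1 - A\<^bsub>I,I\<^esub>\<close>. The multiset \<open>eigenvalues_on I A\<close> counts algebraic multiplicities.
\<close>

definition charpoly_on :: "'n set \<Rightarrow> real ^ 'n ^ 'n \<Rightarrow> complex poly" where
  "charpoly_on I A = det (\<chi> i j.
     if i \<in> I \<and> j \<in> I then (if i = j then [:0, 1:] else 0) - [:complex_of_real (A $ i $ j):]
     else if i = j then 1 else 0)"

definition eigenvalues_on :: "'n set \<Rightarrow> real ^ 'n ^ 'n \<Rightarrow> complex multiset" where
  "eigenvalues_on I A = proots (charpoly_on I A)"

definition multipliers :: "(real ^ 'n \<Rightarrow> real ^ 'n) \<Rightarrow> real ^ 'n \<Rightarrow> complex multiset" where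
  "multipliers F x = eigenvalues_on UNIV (jacobian F (at x))"

definition hyperbolic_fixed_point :: "(real ^ 'n \<Rightarrow> real ^ 'n) \<Rightarrow> real ^ 'n \<Rightarrow> bool" where
  "hyperbolic_fixed_point F x \<longleftrightarrow> F x = x \<and> (\<forall>\<mu>. \<mu> \<in># multipliers F x \<longrightarrow> cmod \<mu> \<noteq> 1)"


definition local_stable_manifold ::
    "('a::topological_space \<Rightarrow> 'a) \<Rightarrow> 'a \<Rightarrow> 'a set \<Rightarrow> 'a set" where
  "local_stable_manifold F p U =
     {z \<in> U. (\<forall>n. (F ^^ n) z \<in> U) \<and> (\<lambda>n. (F ^^ n) z) \<longlonglongrightarrow> p}"

definition stable_manifold_graph_near_0 ::
    "(real ^ 'n \<Rightarrow> real ^ 'n) \<Rightarrow> 'n set \<Rightarrow> (real ^ 'n \<Rightarrow> real ^ 'n) \<Rightarrow> bool" where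
  "stable_manifold_graph_near_0 F I G \<longleftrightarrow>
     (\<exists>U. open U \<and> 0 \<in> U \<and>
        local_stable_manifold F 0 U = {X + G X | X. X \<in> coord_space I} \<inter> U)"


text \<open>
  Box dimension. As \<open>infdist y {} = 0\<close>, the definition of \<open>thickening\<close> is meant for non-empty sets.
  The dimensions are infima in the extended reals, so that an empty set of exponents gives \<open>\<infinity>\<close>
  and not an unspecified real number.
\<close>

definition thickening :: "real \<Rightarrow> 'a::metric_space set \<Rightarrow> 'a set" where
  "thickening \<epsilon> A = {y. infdist y A < \<epsilon>}"

definition lower_Minkowski_content :: "real \<Rightarrow> 'a::euclidean_space set \<Rightarrow> ennreal" where
  "lower_Minkowski_content s A =
     Liminf (at_right 0)
       (\<lambda>\<epsilon>. emeasure lebesgue (thickening \<epsilon> A) / ennreal (\<epsilon> powr (real DIM('a) - s)))"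

definition upper_Minkowski_content :: "real \<Rightarrow> 'a::euclidean_space set \<Rightarrow> ennreal" where
  "upper_Minkowski_content s A =
     Limsup (at_right 0)
       (\<lambda>\<epsilon>. emeasure lebesgue (thickening \<epsilon> A) / ennreal (\<epsilon> powr (real DIM('a) - s)))"

definition lower_box_dim :: "'a::euclidean_space set \<Rightarrow> ereal" where
  "lower_box_dim A = Inf (ereal ` {s. s > 0 \<and> lower_Minkowski_content s A = 0})"

definition upper_box_dim :: "'a::euclidean_space set \<Rightarrow> ereal" where
  "upper_box_dim A = Inf (ereal ` {s. s > 0 \<and> upper_Minkowski_content s A = 0})"

definition has_box_dim :: "'a::euclidean_space set \<Rightarrow> real \<Rightarrow> bool" where
  "has_box_dim A d \<longleftrightarrow> bounded A \<and> lower_box_dim A = ereal d \<and> upper_box_dim A = ereal d"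

end

theory Submission
  imports Defs "HOL-Computational_Algebra.Fundamental_Theorem_Algebra" "HOL-Real_Asymp.Real_Asymp"
begin

text \<open>
  On the stable manifold the dynamics is \<open>X \<mapsto> \<Lambda> X + o(X)\<close>, and \<open>\<Lambda>\<close> is a contraction in an adapted norm because
  its eigenvalues lie inside the unit circle; so every orbit starting near \<open>0\<close> tends to \<open>0\<close>
  exponentially. Hence all but \<open>O(log (1/\<epsilon>))\<close> of its points lie in the \<open>\<epsilon>\<close>-ball around \<open>0\<close>, the
  \<open>\<epsilon>\<close>-thickening has volume \<open>O(\<epsilon>\<^sup>N log (1/\<epsilon>))\<close>, and the box dimension is \<open>0\<close>.

  That the powers of \<open>\<Lambda>\<close> decay is shown without a normal form: each vector \<open>v\<close> is annihilated by a
  polynomial in the matrix, whose linear factors \<open>A - \<mu>\<close> are removed one at a time. If \<open>\<bar>\<mu>\<bar> < 1\<close>, then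
  \<open>A\<^sup>n v\<close> satisfies a contracting recurrence driven by the decaying \<open>A\<^sup>n (A - \<mu>) v\<close>; otherwise \<open>\<mu>\<close>
  is not an eigenvalue and \<open>A - \<mu>\<close> can be inverted.
\<close>

section \<open>Exponentially decaying sequences\<close>

definition exp_decaying :: "(nat \<Rightarrow> 'a::real_normed_vector) \<Rightarrow> bool" where
  "exp_decaying u \<longleftrightarrow> (\<exists>C q. 0 < q \<and> q < 1 \<and> (\<forall>n. norm (u n) \<le> C * q ^ n))"

lemma exp_decaying_bounded_linear_image:
  assumes "bounded_linear f" "exp_decaying u"
  shows "exp_decaying (\<lambda>n. f (u n))"
proof -
  obtain C q where q: "0 < q" "q < 1" and C: "\<And>n. norm (u n) \<le> C * q ^ n"
    using assms(2) unfolding exp_decaying_def by blast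
  obtain K where K: "K > 0" "\<And>x. norm (f x) \<le> norm x * K"
    using bounded_linear.pos_bounded[OF assms(1)] by blast
  have "norm (f (u n)) \<le> (C * K) * q ^ n" for n
  proof -
    have "norm (f (u n)) \<le> norm (u n) * K" by (rule K)
    also have "\<dots> \<le> C * q ^ n * K" using C K(1) by (intro mult_right_mono) auto
    finally show ?thesis by (simp add: mult_ac)
  qed
  then show ?thesis using q unfolding exp_decaying_def by blast
qed

lemma exp_decaying_tendsto_0:
  assumes "exp_decaying u"
  shows "u \<longlonglongrightarrow> 0"
proof -
  obtain C q where q: "0 < q" "q < 1" and C: "\<And>n. norm (u n) \<le> C * q ^ n"
    using assms unfolding exp_decaying_def by blast
  have "(\<lambda>n. C * q ^ n) \<longlonglongrightarrow> C * 0"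
    using q by (intro tendsto_mult tendsto_const LIMSEQ_power_zero) auto
  then show ?thesis
    using C by (intro Lim_null_comparison[of u "\<lambda>n. C * q ^ n"]) auto
qed

text \<open>A bound \<open>D * p ^ n\<close> reproduces itself under the recurrence once
  \<open>p\<close> is at least the rate of the forcing term and \<open>D * (p - a)\<close> dominates
  the constant of that term.\<close>

lemma exp_decaying_first_order_recurrence:
  fixes u :: "nat \<Rightarrow> 'a::real_normed_vector"
  assumes step: "\<And>n. norm (u (Suc n)) \<le> a * norm (u n) + norm (b n)"
    and a: "0 \<le> a" "a < 1" and b: "exp_decaying b"
  shows "exp_decaying u"
proof -
  obtain C q where q: "0 < q" "q < 1" and C: "\<And>n. norm (b n) \<le> C * q ^ n"
    using b unfolding exp_decaying_def by blast
  have C0: "C \<ge> 0" using C[of 0] order_trans[OF norm_ge_zero] by simp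
  \<comment> \<open>The midpoint of \<open>a\<close> and 1 keeps \<open>p\<close> strictly above
    \<open>a\<close>, so that \<open>p - a\<close> can be divided by; with equality a factor
    \<open>n\<close> could appear.\<close>
  define p where "p = max q ((1 + a) / 2)"
  have p: "0 < p" "p < 1" "a < p" "q \<le> p" using q a by (auto simp: p_def max_def)
  define D where "D = max (norm (u 0)) (C / (p - a))"
  have D: "norm (u 0) \<le> D" "C \<le> D * (p - a)"
    using p by (auto simp: D_def pos_divide_le_eq[symmetric])
  have "norm (u n) \<le> D * p ^ n" for n
  proof (induction n)
    case 0 then show ?case using D by simp
  next
    case (Suc n)
    have "norm (u (Suc n)) \<le> a * (D * p ^ n) + C * p ^ n"
      using step[of n] C[of n] mult_left_mono[OF Suc a(1)]
        mult_left_mono[OF power_mono[OF p(4), of n] C0] q by linarith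
    also have "\<dots> \<le> a * (D * p ^ n) + D * (p - a) * p ^ n"
      using D(2) p by (intro add_left_mono mult_right_mono) auto
    finally show ?case by (simp add: algebra_simps)
  qed
  then show ?thesis using p unfolding exp_decaying_def by blast
qed

section \<open>Decay of the powers of a complex matrix\<close>

lemma norm_vector_smult_complex: "norm (c *s (x :: complex ^ 'n)) = cmod c * norm x"
  by (simp add: norm_vec_def vector_scalar_mult_def norm_mult L2_set_right_distrib)

text \<open>This is \<open>p(A) v\<close>, written through the iterates of \<open>v\<close> so that
  no polynomial in a matrix has to be formed.\<close>

abbreviation poly_orbit :: "complex ^ 'n ^ 'n \<Rightarrow> complex poly \<Rightarrow> complex ^ 'n \<Rightarrow> complex ^ 'n" where
  "poly_orbit A p v \<equiv> (\<Sum>i\<le>degree p. coeff p i *s ((*v) A ^^ i) v)"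

lemma funpow_matrix_vector_linear:
  fixes A :: "'a::field ^ 'n ^ 'n"
  shows "((*v) A ^^ n) (x - y) = ((*v) A ^^ n) x - ((*v) A ^^ n) y"
    and "((*v) A ^^ n) (c *s x) = c *s ((*v) A ^^ n) x"
    and "((*v) A ^^ n) 0 = 0"
    and "((*v) A ^^ n) (x + y) = ((*v) A ^^ n) x + ((*v) A ^^ n) y"
    and "((*v) A ^^ n) (A *v x) = A *v ((*v) A ^^ n) x"
  by (induction n) (simp_all add: vec.diff vec.scale vec.add)

text \<open>Splits one root off an annihilating polynomial of \<open>v\<close>, at the price of
  passing from \<open>v\<close> to \<open>(A - \<mu>) v\<close>. Multiplication by the variable
  shifts the coefficients, which is the same as applying \<open>A\<close> once more.\<close>

lemma poly_orbit_linear_factor: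
  assumes "q \<noteq> 0"
  shows "poly_orbit A ([:-\<mu>, 1:] * q) v = poly_orbit A q (A *v v - \<mu> *s v)"
proof -
  let ?T = "\<lambda>i. ((*v) A ^^ i) v"
  have deg: "degree ([:-\<mu>, 1:] * q) = Suc (degree q)"
    using assms by (subst degree_mult_eq) auto
  have co: "coeff ([:-\<mu>, 1:] * q) i = (case i of 0 \<Rightarrow> 0 | Suc j \<Rightarrow> coeff q j) - \<mu> * coeff q i" for i
    by (simp add: coeff_pCons split: nat.split)
  \<comment> \<open>Both sums run to the larger degree: the first loses its zero term and is
    reindexed, the second loses its top term, whose coefficient lies beyond
    \<open>degree q\<close>.\<close>
  have "poly_orbit A ([:-\<mu>, 1:] * q) v =
      (\<Sum>i\<le>Suc (degree q). (case i of 0 \<Rightarrow> 0 | Suc j \<Rightarrow> coeff q j) *s ?T i)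
      - (\<Sum>i\<le>Suc (degree q). (\<mu> * coeff q i) *s ?T i)"
    unfolding deg co by (simp add: vec.scale_left_diff_distrib sum_subtractf del: sum.atMost_Suc)
  also have "(\<Sum>i\<le>Suc (degree q). (case i of 0 \<Rightarrow> 0 | Suc j \<Rightarrow> coeff q j) *s ?T i) =
      (\<Sum>i\<le>degree q. coeff q i *s ?T (Suc i))"
    by (subst sum.atMost_Suc_shift) simp
  also have "(\<Sum>i\<le>Suc (degree q). (\<mu> * coeff q i) *s ?T i) = (\<Sum>i\<le>degree q. (\<mu> * coeff q i) *s ?T i)"
    by (simp add: coeff_eq_0)
  finally show ?thesis
    by (simp add: funpow_matrix_vector_linear vec.scale_right_diff_distrib sum_subtractf mult.commute)
qed

lemma exp_decaying_if_poly_orbit_eq_0: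
  fixes A :: "complex ^ 'n ^ 'n"
  assumes ev: "\<And>\<mu> v. v \<noteq> 0 \<Longrightarrow> A *v v = \<mu> *s v \<Longrightarrow> cmod \<mu> < 1"
    and "p \<noteq> 0" "poly_orbit A p v = 0"
  shows "exp_decaying (\<lambda>n. ((*v) A ^^ n) v)"
  using assms(2,3)
proof (induction "degree p" arbitrary: p v)
  case 0
  \<comment> \<open>A nonzero constant annihilates only the zero vector.\<close>
  then obtain c where "p = [:c:]" "c \<noteq> 0" by (metis degree_eq_zeroE pCons_0_0)
  with 0 have "v = 0" by simp
  then show ?case
    by (auto simp: exp_decaying_def funpow_matrix_vector_linear intro!: exI[of _ 0] exI[of _ "1/2"])
next
  case (Suc d)
  obtain \<mu> where "poly p \<mu> = 0"
    using alg_closed_imp_poly_has_root[of p] Suc.hyps by auto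
  then obtain q where pq: "p = [:-\<mu>, 1:] * q" by (metis dvdE poly_eq_0_iff_dvd)
  have q0: "q \<noteq> 0" using pq Suc.prems by auto
  have dq: "d = degree q" using Suc.hyps q0 unfolding pq by (subst (asm) degree_mult_eq) auto
  define w where "w = A *v v - \<mu> *s v"
  \<comment> \<open>The quotient \<open>q\<close> annihilates \<open>w\<close>, so the induction
    hypothesis applies to \<open>w\<close>.\<close>
  have w: "exp_decaying (\<lambda>n. ((*v) A ^^ n) w)"
    using Suc.prems(2) unfolding pq poly_orbit_linear_factor[OF q0]
    by (intro Suc.hyps(1)[OF dq q0]) (simp add: w_def)
  have wn: "((*v) A ^^ n) w = A *v ((*v) A ^^ n) v - \<mu> *s ((*v) A ^^ n) v" for n
    by (simp add: w_def funpow_matrix_vector_linear)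
  show ?case
  proof (cases "cmod \<mu> < 1")
    case True
    have "norm (((*v) A ^^ Suc n) v) \<le> cmod \<mu> * norm (((*v) A ^^ n) v) + norm (((*v) A ^^ n) w)" for n
      using norm_triangle_ineq[of "\<mu> *s ((*v) A ^^ n) v" "((*v) A ^^ n) w"]
      by (simp add: wn norm_vector_smult_complex)
    then show ?thesis
      by (rule exp_decaying_first_order_recurrence[OF _ norm_ge_zero True w])
  next
    case False
    let ?M = "A - mat \<mu>"
    have M: "?M *v x = A *v x - \<mu> *s x" for x
      by (simp add: matrix_vector_mult_diff_rdistrib)
         (simp add: vec_eq_iff matrix_vector_mult_def mat_def if_distrib [where f="\<lambda>x. x * _"] cong: if_cong)
    \<comment> \<open>A nonzero kernel vector would be an eigenvector for \<mu>, of modulus at least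
      1. A left inverse \<open>B\<close> suffices: it recovers \<open>A^n v\<close> from
      \<open>A^n w = (A - \<mu>) A^n v\<close>.\<close>
    have "\<forall>x. ?M *v x = 0 \<longrightarrow> x = 0" using ev False by (auto simp: M)
    then obtain B where B: "B ** ?M = mat 1" using matrix_left_invertible_ker by blast
    have "((*v) A ^^ n) v = B *v ((*v) A ^^ n) w" for n
      unfolding wn M[symmetric] by (simp add: matrix_vector_mul_assoc B)
    then show ?thesis
      using exp_decaying_bounded_linear_image[OF matrix_vector_mul_bounded_linear w, of B] by simp
  qed
qed

text \<open>The vectors \<open>v, A v, ...\<close> up to exponent \<open>CARD('n)\<close> are one
  more than the dimension; the coefficients of a linear relation between them form
  \<open>p\<close>.\<close>

lemma exists_poly_orbit_eq_0:
  fixes A :: "complex ^ 'n ^ 'n"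
  obtains p where "p \<noteq> 0" "poly_orbit A p v = 0"
proof -
  let ?T = "\<lambda>i. ((*v) A ^^ i) v"
  have po: "poly_orbit A p v = (\<Sum>i\<le>N. coeff p i *s ?T i)" if "degree p \<le> N" for p N
    using that by (intro sum.mono_neutral_left) (auto simp: coeff_eq_0)
  show ?thesis
  \<comment> \<open>Linear dependence is a property of sets and does not see repetitions. If two
    iterates coincide, the difference of two monomials annihilates \<open>v\<close>
    directly.\<close>
  proof (cases "inj_on ?T {..CARD('n)}")
    case False
    then obtain i j where ij: "i < j" "?T i = ?T j"
      using linorder_inj_onI'[of "{..CARD('n)}" ?T] by blast
    let ?p = "monom 1 j - monom (1::complex) i"
    have dp: "degree ?p \<le> j"
      using ij by (intro degree_diff_le) (auto simp: degree_monom_eq)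
    have "coeff ?p j \<noteq> 0" using ij by simp
    then have "?p \<noteq> 0" by (metis coeff_0)
    moreover have "poly_orbit A ?p v = 0"
      using ij by (subst po[OF dp]) (simp add: vec.scale_left_diff_distrib sum_subtractf
          if_distrib[where f="\<lambda>x. x *s _"] cong: if_cong)
    ultimately show ?thesis using that by blast
  next
    case True
    let ?S = "?T ` {..CARD('n)}"
    have "vec.dependent ?S"
    proof (rule vec.dependent_biggerset_general)
      have "vec.dim ?S \<le> CARD('n)" using vec.dim_subset[OF subset_UNIV, of ?S] unfolding vec_dim_card .
      then show "card ?S > vec.dim ?S" unfolding card_image[OF True] card_atMost by linarith
    qed
    then obtain u where u: "(\<Sum>x\<in>?S. u x *s x) = 0" "\<exists>x\<in>?S. u x \<noteq> 0"
      unfolding vec.dependent_finite[OF finite_imageI[OF finite_atMost]] by blast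
    define p where "p = (\<Sum>i\<le>CARD('n). monom (u (?T i)) i)"
    have co: "coeff p i = (if i \<le> CARD('n) then u (?T i) else 0)" for i
      by (simp add: p_def coeff_sum)
    have "degree p \<le> CARD('n)" by (rule degree_le) (simp add: co)
    then have "poly_orbit A p v = (\<Sum>i\<le>CARD('n). u (?T i) *s ?T i)"
      by (subst po) (auto simp: co)
    also have "\<dots> = 0" using u(1) by (simp add: sum.reindex[OF True])
    finally have po0: "poly_orbit A p v = 0" .
    obtain i where "i \<le> CARD('n)" "u (?T i) \<noteq> 0" using u(2) by blast
    then have "coeff p i \<noteq> 0" by (simp add: co)
    then have "p \<noteq> 0" by force
    then show ?thesis using po0 by (rule that)
  qed
qed

lemma exp_decaying_matrix_powers:
  fixes A :: "complex ^ 'n ^ 'n"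
  assumes "\<And>\<mu> v. v \<noteq> 0 \<Longrightarrow> A *v v = \<mu> *s v \<Longrightarrow> cmod \<mu> < 1"
  shows "exp_decaying (\<lambda>n. ((*v) A ^^ n) v)"
proof -
  obtain p where p: "p \<noteq> 0" "poly_orbit A p v = 0" by (rule exists_poly_orbit_eq_0)
  show ?thesis by (rule exp_decaying_if_poly_orbit_eq_0[OF _ p]) (rule assms)
qed

section \<open>Contraction by a power of the real block matrix\<close>

lemma poly_det: "poly (det M) x = det (\<chi> i j. poly (M $ i $ j) x)"
  by (simp add: det_def poly_sum poly_prod)

text \<open>As \<mu> is nonzero and \<open>L\<close> vanishes outside the block, the eigenvector is
  supported on \<open>I\<close> and hence is an eigenvector of the block. The eigenvalue 0 is
  excluded because the zero rows outside the block may produce it.\<close>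

lemma eigenvalue_in_eigenvalues_on:
  fixes L :: "real ^ 'n ^ 'n" and v :: "complex ^ 'n"
  assumes supp: "\<forall>i j. i \<notin> I \<or> j \<notin> I \<longrightarrow> L $ i $ j = 0"
    and nz: "charpoly_on I L \<noteq> 0"
    and v: "v \<noteq> 0" "(\<chi> i j. complex_of_real (L $ i $ j)) *v v = \<mu> *s v" and "\<mu> \<noteq> 0"
  shows "\<mu> \<in># eigenvalues_on I L"
proof -
  have eq: "(\<Sum>j\<in>UNIV. complex_of_real (L $ i $ j) * v $ j) = \<mu> * v $ i" for i
    using v(2) by (auto simp: vec_eq_iff matrix_vector_mult_def)
  have v0: "v $ i = 0" if "i \<notin> I" for i
    using eq[of i] supp that \<open>\<mu> \<noteq> 0\<close> by simp
  \<comment> \<open>This is the matrix of \<open>charpoly_on I L\<close> evaluated at \<mu>;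
    \<open>v\<close> will lie in its kernel.\<close>
  let ?B = "\<chi> i j. if i \<in> I \<and> j \<in> I then (if i = j then \<mu> else 0) - complex_of_real (L $ i $ j)
     else if i = j then 1 else 0"
  have "(?B *v v) $ i = 0" for i
  proof (cases "i \<in> I")
    case True
    have "(?B *v v) $ i = (\<Sum>j\<in>UNIV. ((if i = j then \<mu> else 0) - complex_of_real (L $ i $ j)) * v $ j)"
      using True v0 by (auto simp: matrix_vector_mult_def intro!: sum.cong)
    also have "\<dots> = (\<Sum>j\<in>UNIV. (if i = j then \<mu> * v $ j else 0)) - (\<Sum>j\<in>UNIV. complex_of_real (L $ i $ j) * v $ j)"
      unfolding sum_subtractf[symmetric] by (intro sum.cong) (auto simp: algebra_simps)
    also have "\<dots> = 0" unfolding eq by simp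
    finally show ?thesis .
  next
    case False
    then have "(?B *v v) $ i = (\<Sum>j\<in>UNIV. if i = j then v $ j else 0)"
      by (simp add: matrix_vector_mult_def if_distrib[where f="\<lambda>x. x * _"] cong: if_cong)
    then show ?thesis using v0[OF False] by simp
  qed
  then have "?B *v v = 0" by (simp add: vec_eq_iff)
  then have "\<not> inj ((*v) ?B)" using v(1) vec.inj_iff_eq_0 by blast
  then have "det ?B = 0"
    using inj_matrix_vector_mult[of ?B] invertible_det_nz[of ?B] by blast
  moreover have "poly (charpoly_on I L) \<mu> = det ?B"
    unfolding charpoly_on_def poly_det by (rule arg_cong[of _ _ det]) (simp add: vec_eq_iff)
  ultimately show ?thesis using nz by (simp add: eigenvalues_on_def)
qed

lemma block_matrix_power_contracts:
  fixes L :: "real ^ 'n ^ 'n"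
  assumes supp: "\<forall>i j. i \<notin> I \<or> j \<notin> I \<longrightarrow> L $ i $ j = 0"
    and nz: "charpoly_on I L \<noteq> 0"
    and lt: "\<And>\<mu>. \<mu> \<in># eigenvalues_on I L \<Longrightarrow> cmod \<mu> < 1"
  shows "\<exists>k>0. \<forall>x. norm (((*v) L ^^ k) x) \<le> norm x / 2"
proof -
  \<comment> \<open>Complexification \<open>?c\<close> is isometric and intertwines \<open>L\<close>
    with \<open>?A\<close>, so decay transfers back to real vectors.\<close>
  let ?A = "(\<chi> i j. complex_of_real (L $ i $ j)) :: complex ^ 'n ^ 'n"
  let ?c = "\<lambda>x :: real ^ 'n. (\<chi> i. complex_of_real (x $ i)) :: complex ^ 'n"
  have c1: "?A *v ?c x = ?c (L *v x)" for x
    by (simp add: vec_eq_iff matrix_vector_mult_def)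
  have cn: "((*v) ?A ^^ n) (?c x) = ?c (((*v) L ^^ n) x)" for n x
    by (induction n) (simp_all add: c1)
  have nc: "norm (?c x) = norm x" for x by (simp add: norm_vec_def)
  have "cmod \<mu> < 1" if "v \<noteq> 0" "?A *v v = \<mu> *s v" for \<mu> v
    using eigenvalue_in_eigenvalues_on[OF supp nz that] lt by (cases "\<mu> = 0") auto
  then have "exp_decaying (\<lambda>n. ((*v) ?A ^^ n) (?c x))" for x
    by (rule exp_decaying_matrix_powers)
  then have "(\<lambda>n. norm (((*v) ?A ^^ n) (?c x))) \<longlonglongrightarrow> 0" for x
    using exp_decaying_tendsto_0 tendsto_norm_zero by blast
  then have lim: "(\<lambda>n. norm (((*v) L ^^ n) x)) \<longlonglongrightarrow> 0" for x
    unfolding cn nc .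
  \<comment> \<open>Pointwise decay becomes uniform in \<open>x\<close>: the operator norm is at
    most the sum of the norms of the images of the finitely many basis vectors.\<close>
  have "(\<lambda>n. \<Sum>i\<in>UNIV. norm (((*v) L ^^ n) (axis i 1))) \<longlonglongrightarrow> 0"
    by (intro tendsto_null_sum lim)
  then have "eventually (\<lambda>n. (\<Sum>i\<in>UNIV. norm (((*v) L ^^ n) (axis i 1))) < 1/2) sequentially"
    by (rule order_tendstoD) simp
  then obtain k where "k > 0" and k: "(\<Sum>i\<in>UNIV. norm (((*v) L ^^ k) (axis i 1))) < 1/2"
    unfolding eventually_sequentially by (meson le_Suc_eq order_refl zero_less_Suc)
  have "norm (((*v) L ^^ k) x) \<le> norm x / 2" for x
  proof -
    have sm: "((*v) L ^^ k) (\<Sum>i\<in>S. f i) = (\<Sum>i\<in>S. ((*v) L ^^ k) (f i))" if "finite S" for S f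
      using that by induction (simp_all add: funpow_matrix_vector_linear)
    have "((*v) L ^^ k) x = (\<Sum>i\<in>UNIV. x $ i *s ((*v) L ^^ k) (axis i 1))"
      by (subst basis_expansion[of x, symmetric]) (simp add: sm funpow_matrix_vector_linear)
    also have "norm \<dots> \<le> (\<Sum>i\<in>UNIV. norm x * norm (((*v) L ^^ k) (axis i 1)))"
      by (rule order_trans[OF norm_sum], rule sum_mono)
         (simp add: scalar_mult_eq_scaleR mult_right_mono component_le_norm_cart)
    also have "\<dots> \<le> norm x * (1/2)"
      unfolding sum_distrib_left[symmetric] using k by (intro mult_left_mono) auto
    finally show ?thesis by simp
  qed
  then show ?thesis using \<open>k > 0\<close> by blast
qed

section \<open>Volume of thickenings and box dimension\<close>

text \<open>One ball of radius \<open>2 * \<epsilon>\<close> covers the thickening of the tail and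
  contributes \<open>2 ^ DIM('a)\<close>; each of the first \<open>K\<close> points costs one
  \<epsilon>-ball. The summand 2 leaves room for rounding \<open>K\<close> up.\<close>

lemma emeasure_thickening_le_if_exp_bound:
  fixes z :: "nat \<Rightarrow> 'a::euclidean_space"
  assumes z: "\<And>n. norm (z n) \<le> C * p ^ n" and C: "C > 0" and p: "0 < p" "p < 1"
    and \<epsilon>: "0 < \<epsilon>" "\<epsilon> < C"
  shows "emeasure lebesgue (thickening \<epsilon> (range z)) \<le>
    ennreal ((ln (C / \<epsilon>) / ln (1 / p) + 2 + 2 ^ DIM('a)) * unit_ball_vol DIM('a) * \<epsilon> ^ DIM('a))"
proof -
  let ?V = "unit_ball_vol DIM('a)"
  \<comment> \<open>\<open>K\<close> is the first index at which \<open>C * p ^ K\<close> is at most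
    \<epsilon>.\<close>
  define K where "K = nat \<lceil>ln (C / \<epsilon>) / ln (1 / p)\<rceil>"
  have lnp: "ln (1 / p) > 0" using p by simp
  have quot: "ln (C / \<epsilon>) / ln (1 / p) \<ge> 0" using \<epsilon> C lnp by (intro divide_nonneg_pos) auto
  have K: "ln (C / \<epsilon>) / ln (1 / p) \<le> real K" "real K \<le> ln (C / \<epsilon>) / ln (1 / p) + 1"
    using quot unfolding K_def by linarith+
  have "C / \<epsilon> \<le> (1 / p) ^ K"
  proof -
    have "ln (C / \<epsilon>) \<le> real K * ln (1 / p)" using K(1) lnp by (simp add: pos_divide_le_eq)
    also have "\<dots> = ln ((1 / p) ^ K)" using p by (subst ln_realpow) auto
    finally show ?thesis using C \<epsilon> p by (subst (asm) ln_le_cancel_iff) auto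
  qed
  then have CK: "C * p ^ K \<le> \<epsilon>" using p \<epsilon> by (simp add: field_simps)
  have tail: "norm (z n) \<le> \<epsilon>" if "n \<ge> K" for n
  proof -
    have "C * p ^ n \<le> C * p ^ K" using that p C by (intro mult_left_mono power_decreasing) auto
    then show ?thesis using z[of n] CK by linarith
  qed
  have sub: "thickening \<epsilon> (range z) \<subseteq> ball 0 (2 * \<epsilon>) \<union> (\<Union>n<K. ball (z n) \<epsilon>)"
  proof
    fix y assume "y \<in> thickening \<epsilon> (range z)"
    then have "infdist y (range z) < \<epsilon>" by (simp add: thickening_def)
    then obtain n where n: "dist y (z n) < \<epsilon>"
      using cInf_lessD[of "dist y ` range z" \<epsilon>] by (auto simp: infdist_def)
    show "y \<in> ball 0 (2 * \<epsilon>) \<union> (\<Union>n<K. ball (z n) \<epsilon>)"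
    proof (cases "n < K")
      case True then show ?thesis using n by (auto simp: dist_commute)
    next
      case False
      then have "norm y < 2 * \<epsilon>"
        using tail[of n] n norm_triangle_ineq[of "y - z n" "z n"] by (simp add: dist_norm)
      then show ?thesis by simp
    qed
  qed
  have "emeasure lebesgue (thickening \<epsilon> (range z)) \<le>
      emeasure lebesgue (ball 0 (2 * \<epsilon>) \<union> (\<Union>n<K. ball (z n) \<epsilon>))"
    by (rule emeasure_mono[OF sub]) auto
  also have "\<dots> \<le> emeasure lebesgue (ball (0::'a) (2 * \<epsilon>)) + emeasure lebesgue (\<Union>n<K. ball (z n) \<epsilon>)"
    by (rule emeasure_subadditive) auto
  also have "\<dots> \<le> emeasure lebesgue (ball (0::'a) (2 * \<epsilon>)) + (\<Sum>n<K. emeasure lebesgue (ball (z n) \<epsilon>))"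
    by (intro add_left_mono emeasure_subadditive_finite) auto
  also have "\<dots> = ennreal (?V * (2 * \<epsilon>) ^ DIM('a)) + ennreal (real K) * ennreal (?V * \<epsilon> ^ DIM('a))"
    using \<epsilon> by (simp add: emeasure_ball ennreal_of_nat_eq_real_of_nat)
  also have "\<dots> = ennreal (?V * (2 * \<epsilon>) ^ DIM('a) + real K * (?V * \<epsilon> ^ DIM('a)))"
    using \<epsilon> by (simp add: ennreal_plus[symmetric] ennreal_mult[symmetric] del: ennreal_plus)
  also have "\<dots> \<le> ennreal ((ln (C / \<epsilon>) / ln (1 / p) + 2 + 2 ^ DIM('a)) * ?V * \<epsilon> ^ DIM('a))"
  proof (rule ennreal_leI)
    have "real K * (?V * \<epsilon> ^ DIM('a)) \<le> (ln (C / \<epsilon>) / ln (1 / p) + 2) * (?V * \<epsilon> ^ DIM('a))"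
      using K(2) \<epsilon> by (intro mult_right_mono) auto
    then show "?V * (2 * \<epsilon>) ^ DIM('a) + real K * (?V * \<epsilon> ^ DIM('a)) \<le>
        (ln (C / \<epsilon>) / ln (1 / p) + 2 + 2 ^ DIM('a)) * ?V * \<epsilon> ^ DIM('a)"
      by (simp add: power_mult_distrib algebra_simps)
  qed
  finally show ?thesis .
qed

text \<open>After division by \<open>\<epsilon> powr (N - s)\<close> the volume bound is of order
  \<open>\<epsilon> powr s\<close> times a logarithm, which tends to 0 for every positive
  \<open>s\<close>. So both sets of exponents are all of \<open>{0<..}\<close>.\<close>

lemma has_box_dim_0_if_exp_decaying:
  fixes z :: "nat \<Rightarrow> 'a::euclidean_space"
  assumes "exp_decaying z"
  shows "has_box_dim (range z) 0"
proof -
  obtain C' p where z': "\<And>n. norm (z n) \<le> C' * p ^ n" and p: "0 < p" "p < 1"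
    using assms unfolding exp_decaying_def by blast
  \<comment> \<open>Enlarging the constant makes it positive, so that \<open>ln C\<close> splits off
    from \<open>ln (C / \<epsilon>)\<close>.\<close>
  define C where "C = max C' 1"
  have C: "C > 0" by (simp add: C_def)
  have z: "norm (z n) \<le> C * p ^ n" for n
    using p by (intro order_trans[OF z'] mult_right_mono) (auto simp: C_def)
  let ?N = "DIM('a)"
  let ?c = "\<lambda>s \<epsilon>. emeasure lebesgue (thickening \<epsilon> (range z)) / ennreal (\<epsilon> powr (real ?N - s))"
  have lim: "(?c s \<longlongrightarrow> 0) (at_right 0)" if s: "s > 0" for s
  proof -
    define l a V where "l = ln (1 / p)" and "a = 2 + 2 ^ ?N + ln C / l" and "V = unit_ball_vol ?N"
    let ?g = "\<lambda>\<epsilon>. (a - ln \<epsilon> / l) * V * \<epsilon> powr s"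
    have l: "l > 0" using p by (simp add: l_def)
    have ev: "eventually (\<lambda>\<epsilon>. 0 < \<epsilon> \<and> \<epsilon> < C) (at_right (0::real))"
      using eventually_at_right_less C by (auto simp: eventually_at_right_field)
    have le: "eventually (\<lambda>\<epsilon>. ?c s \<epsilon> \<le> ennreal (?g \<epsilon>)) (at_right 0)"
      using ev
    proof eventually_elim
      case (elim \<epsilon>)
      have "?c s \<epsilon> \<le> ennreal ((ln (C / \<epsilon>) / l + 2 + 2 ^ ?N) * V * \<epsilon> ^ ?N) / ennreal (\<epsilon> powr (real ?N - s))"
        unfolding l_def V_def
        by (intro divide_right_mono_ennreal emeasure_thickening_le_if_exp_bound[OF z C p]) (use elim in auto)
      also have "(ln (C / \<epsilon>) / l + 2 + 2 ^ ?N) * V * \<epsilon> ^ ?N = ?g \<epsilon> * \<epsilon> powr (real ?N - s)"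
      proof -
        have "\<epsilon> powr s * \<epsilon> powr (real ?N - s) = \<epsilon> ^ ?N"
          using elim by (simp add: powr_add[symmetric] powr_realpow)
        then show ?thesis
          using elim C by (simp add: a_def ln_div diff_divide_distrib mult.assoc)
      qed
      also have "ennreal (?g \<epsilon> * \<epsilon> powr (real ?N - s)) / ennreal (\<epsilon> powr (real ?N - s)) = ennreal (?g \<epsilon>)"
      proof -
        \<comment> \<open>Nonnegativity of \<open>?g\<close> has to be checked because
          \<open>ennreal\<close> truncates negative numbers to 0.\<close>
        have "ln C - ln \<epsilon> \<ge> 0" using elim C by simp
        then have "(ln C - ln \<epsilon>) / l \<ge> 0" using l by simp
        then have "a - ln \<epsilon> / l \<ge> 0" unfolding a_def diff_divide_distrib
          using zero_le_power[of "2::real" ?N] by linarith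
        then have "?g \<epsilon> \<ge> 0" by (simp add: V_def)
        then show ?thesis using elim by (simp add: divide_ennreal)
      qed
      finally show ?case .
    qed
    have "(?g \<longlongrightarrow> 0) (at_right 0)" using s l by real_asymp
    then have lim_g: "((\<lambda>\<epsilon>. ennreal (?g \<epsilon>)) \<longlongrightarrow> 0) (at_right 0)"
      using tendsto_ennrealI[of ?g 0] by simp
    show ?thesis
      by (rule tendsto_sandwich[where f = "\<lambda>_. 0", OF _ le tendsto_const lim_g]) simp
  qed
  have "Limsup (at_right 0) (?c s) = 0" "Liminf (at_right 0) (?c s) = 0" if "s > 0" for s
    using lim_imp_Limsup[OF _ lim[OF that]] lim_imp_Liminf[OF _ lim[OF that]] by auto
  then have sets: "{s. s > 0 \<and> upper_Minkowski_content s (range z) = 0} = {0<..}"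
    "{s. s > 0 \<and> lower_Minkowski_content s (range z) = 0} = {0<..}"
    unfolding upper_Minkowski_content_def lower_Minkowski_content_def by auto
  have "Inf (ereal ` {0<..}) = ereal 0"
  proof (rule Inf_eqI)
    fix y assume *: "\<And>i. i \<in> ereal ` {0<..} \<Longrightarrow> y \<le> i"
    show "y \<le> ereal 0"
      by (rule ereal_le_epsilon2) (use * in auto)
  qed auto
  moreover have "norm x \<le> C" if "x \<in> range z" for x
  proof -
    obtain n where n: "x = z n" using \<open>x \<in> range z\<close> by blast
    have "C * p ^ n \<le> C * 1" using p C by (intro mult_left_mono power_le_one) auto
    then show ?thesis using z[of n] n by simp
  qed
  then have "bounded (range z)" by (auto simp: bounded_iff)
  ultimately show ?thesis
    unfolding has_box_dim_def lower_box_dim_def upper_box_dim_def sets by simp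
qed

section \<open>Exponential decay of nonlinear orbits\<close>

text \<open>\<open>N\<close> sums the norms of the first \<open>k\<close> iterates. Applying
  \<open>L\<close> shifts this sum: \<open>norm x\<close> drops out and the norm of the
  \<open>k\<close>-th iterate, at most half as large, enters.\<close>

lemma adapted_norm:
  fixes L :: "real ^ 'n ^ 'n"
  assumes k: "k > 0" "\<And>x. norm (((*v) L ^^ k) x) \<le> norm x / 2"
  obtains N :: "real ^ 'n \<Rightarrow> real" and M where
    "M \<ge> 1" "\<And>x. norm x \<le> N x" "\<And>x. N x \<le> M * norm x"
    "\<And>x y. N (x + y) \<le> N x + N y" "\<And>x. N (L *v x) \<le> N x - norm x / 2"
proof -
  define N where "N x = (\<Sum>j<k. norm (((*v) L ^^ j) x))" for x
  have "bounded_linear ((*v) L ^^ j)" for j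
  proof (induction j)
    case 0 then show ?case by (simp add: id_def bounded_linear_ident)
  next
    case (Suc j)
    then show ?case
      using bounded_linear_compose[OF matrix_vector_mul_bounded_linear, of _ L] by (simp add: o_def)
  qed
  then have "\<exists>B. \<forall>x. norm (((*v) L ^^ j) x) \<le> norm x * B" for j
    using bounded_linear.bounded by blast
  then obtain B where B: "\<And>j x. norm (((*v) L ^^ j) x) \<le> norm x * B j" by metis
  define M where "M = max 1 (\<Sum>j<k. B j)"
  show thesis
  proof (rule that)
    show "M \<ge> 1" by (simp add: M_def)
    show "norm x \<le> N x" for x
      unfolding N_def using k(1) member_le_sum[of 0 "{..<k}" "\<lambda>j. norm (((*v) L ^^ j) x)"] by simp
    show "N x \<le> M * norm x" for x
    proof -
      have "N x \<le> (\<Sum>j<k. norm x * B j)" unfolding N_def by (intro sum_mono B)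
      also have "\<dots> = (\<Sum>j<k. B j) * norm x" by (simp add: sum_distrib_left mult.commute)
      also have "\<dots> \<le> M * norm x" by (intro mult_right_mono) (auto simp: M_def)
      finally show ?thesis .
    qed
    show "N (x + y) \<le> N x + N y" for x y
      unfolding N_def sum.distrib[symmetric]
      by (intro sum_mono) (simp add: funpow_matrix_vector_linear norm_triangle_ineq)
    show "N (L *v x) \<le> N x - norm x / 2" for x
    proof -
      have "N (L *v x) = (\<Sum>j<k. norm (((*v) L ^^ Suc j) x))"
        by (simp add: N_def funpow_matrix_vector_linear)
      also have "\<dots> + norm x = (\<Sum>j<Suc k. norm (((*v) L ^^ j) x))"
        by (subst sum.lessThan_Suc_shift) simp
      also have "\<dots> \<le> N x + norm x / 2"
        using k(2)[of x] by (simp add: N_def)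
      finally show ?thesis by simp
    qed
  qed
qed

text \<open>The linear part lowers \<open>N\<close> by half of \<open>norm x\<close>, and near 0 the
  perturbation gives back at most a quarter. The net loss of a quarter is at least
  \<open>N x / (4 * M)\<close>, whence the rate \<open>p\<close>.\<close>

lemma linearized_orbit_exp_decay:
  fixes L :: "real ^ 'n ^ 'n" and h :: "real ^ 'n \<Rightarrow> real ^ 'n"
  assumes k: "k > 0" "\<And>x. norm (((*v) L ^^ k) x) \<le> norm x / 2"
    and small: "\<And>\<delta>. \<delta> > 0 \<Longrightarrow> \<exists>\<eta>>0. \<forall>x\<in>S. norm x < \<eta> \<longrightarrow> norm (h x) \<le> \<delta> * norm x"
    and \<eta>\<^sub>0: "\<eta>\<^sub>0 > 0"
  shows "\<exists>\<rho>>0. \<forall>x. (\<forall>n. x n \<in> S \<and> x (Suc n) = L *v x n + h (x n)) \<and> norm (x 0) < \<rho> \<longrightarrow>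
    (\<forall>n. norm (x n) < \<eta>\<^sub>0) \<and> exp_decaying x"
proof -
  obtain N M where M: "M \<ge> 1" and N: "\<And>x. norm x \<le> N x" "\<And>x. N x \<le> M * norm x"
    "\<And>x y. N (x + y) \<le> N x + N y" "\<And>x. N (L *v x) \<le> N x - norm x / 2"
    by (rule adapted_norm[OF k]) (rule that)
  obtain \<eta>\<^sub>1 where \<eta>\<^sub>1: "\<eta>\<^sub>1 > 0" "\<And>x. x \<in> S \<Longrightarrow> norm x < \<eta>\<^sub>1 \<Longrightarrow> norm (h x) \<le> 1 / (4 * M) * norm x"
    using small[of "1 / (4 * M)"] M by auto
  define \<eta> where "\<eta> = min \<eta>\<^sub>0 \<eta>\<^sub>1"
  define p where "p = 1 - 1 / (4 * M)"
  have p: "0 < p" "p < 1" using M by (auto simp: p_def field_simps)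
  have \<eta>: "\<eta> > 0" using \<eta>\<^sub>1 \<eta>\<^sub>0 by (simp add: \<eta>_def)
  have "(\<forall>n. norm (x n) < \<eta>\<^sub>0) \<and> exp_decaying x"
    \<comment> \<open>The radius is divided by \<open>M\<close> so that \<open>N (x 0)\<close>, and
      not only the norm of \<open>x 0\<close>, is below \<eta>.\<close>
    if x: "\<And>n. x n \<in> S \<and> x (Suc n) = L *v x n + h (x n)" and x0: "norm (x 0) < \<eta> / M" for x
  proof -
    \<comment> \<open>Decay and confinement are proved together: the bound at \<open>n\<close> keeps
      \<open>x n\<close> where \<open>h\<close> is small, which yields the bound at
      \<open>Suc n\<close>.\<close>
    have "N (x n) < \<eta> * p ^ n" for n
    proof (induction n)
      case 0
      have "N (x 0) \<le> M * norm (x 0)" by (rule N)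
      also have "\<dots> < \<eta>" using x0 M by (simp add: pos_less_divide_eq mult.commute)
      finally show ?case by simp
    next
      case (Suc n)
      have "\<eta> * p ^ n \<le> \<eta> * 1" using p \<eta> by (intro mult_left_mono power_le_one) auto
      then have "norm (x n) < \<eta>\<^sub>1" using Suc N(1)[of "x n"] by (simp add: \<eta>_def)
      then have "M * norm (h (x n)) \<le> M * (1 / (4 * M) * norm (x n))"
        using \<eta>\<^sub>1(2) x M by (intro mult_left_mono) auto
      then have "N (h (x n)) \<le> norm (x n) / 4" using N(2)[of "h (x n)"] M by simp
      then have "N (x (Suc n)) \<le> N (x n) - norm (x n) / 4"
        using N(3)[of "L *v x n" "h (x n)"] N(4)[of "x n"] x by simp
      also have "\<dots> \<le> p * N (x n)"
        using N(2)[of "x n"] M by (simp add: p_def field_simps)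
      also have "\<dots> < p * (\<eta> * p ^ n)" using Suc p by (intro mult_strict_left_mono)
      finally show ?case by (simp add: mult_ac)
    qed
    then have le: "norm (x n) < \<eta> * p ^ n" for n using N(1)[of "x n"] by (meson le_less_trans)
    moreover have "\<eta> * p ^ n \<le> \<eta> * 1" for n using p \<eta> by (intro mult_left_mono power_le_one) auto
    ultimately have "norm (x n) < \<eta>\<^sub>0" for n by (smt (verit) \<eta>_def)
    moreover have "exp_decaying x" unfolding exp_decaying_def using le p less_imp_le by blast
    ultimately show ?thesis by blast
  qed
  moreover have "\<eta> / M > 0" using M \<eta> by simp
  ultimately show ?thesis by blast
qed

section \<open>Orbits on the stable manifold\<close>

lemma has_derivative_0_imp_small:
  fixes f :: "'a::real_normed_vector \<Rightarrow> 'b::real_normed_vector"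
  assumes "(f has_derivative (\<lambda>_. 0)) (at 0)" "f 0 = 0" "\<delta> > 0"
  shows "\<exists>\<eta>>0. \<forall>x. norm x < \<eta> \<longrightarrow> norm (f x) \<le> \<delta> * norm x"
  using assms by (auto simp: has_derivative_at_alt)

theorem theorem5:
  fixes F F\<^sub>2 G :: "real ^ 'n \<Rightarrow> real ^ 'n"
    and \<Lambda> :: "real ^ 'n ^ 'n"
    and I :: "'n set"
    and r m :: nat
  assumes "r \<ge> 1"
    and "Ck_near r F 0"
    and "hyperbolic_fixed_point F 0"
    and "size {#\<mu> \<in># multipliers F 0. cmod \<mu> < 1#} = m"
    and "size {#\<mu> \<in># multipliers F 0. cmod \<mu> > 1#} = CARD('n) - m"
    and "card I = m"
    and "\<forall>i j. i \<notin> I \<or> j \<notin> I \<longrightarrow> \<Lambda> $ i $ j = 0"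
    and "eigenvalues_on I \<Lambda> = {#\<mu> \<in># multipliers F 0. cmod \<mu> < 1#}"
    and "\<forall>\<^sub>F z in nhds 0. coord_proj I (F z) = \<Lambda> *v coord_proj I z + F\<^sub>2 z"
    and "\<forall>z. F\<^sub>2 z \<in> coord_space I"
    and "Ck_near r F\<^sub>2 0"
    and "F\<^sub>2 0 = 0"
    and "(F\<^sub>2 has_derivative (\<lambda>_. 0)) (at 0)"
    and "\<forall>X \<in> coord_space I. G X \<in> coord_space (- I)"
    and "Ck_near r (\<lambda>z. G (coord_proj I z)) 0"
    and "G 0 = 0"
    and "((\<lambda>z. G (coord_proj I z)) has_derivative (\<lambda>_. 0)) (at 0)"
    and "stable_manifold_graph_near_0 F I G"
  shows "\<exists>\<rho>>0. \<forall>X Y :: nat \<Rightarrow> real ^ 'n.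
           (\<forall>n\<ge>1. X n \<in> coord_space I \<and> Y n = G (X n)) \<and>
           (\<forall>n\<ge>1. X (Suc n) + Y (Suc n) = F (X n + Y n)) \<and>
           (\<forall>n\<ge>1. X (Suc n) = \<Lambda> *v X n + F\<^sub>2 (X n + G (X n))) \<and>
           norm (X 1 + Y 1) < \<rho>
           \<longrightarrow> has_box_dim {X n + Y n | n. n \<ge> 1} 0"
proof -
  \<comment> \<open>The multiset \<open>proots 0\<close> is empty, so the eigenvalue count excludes a vanishing polynomial.\<close>
  have nz: "charpoly_on I \<Lambda> \<noteq> 0"
  proof (cases "I = {}")
    case True
    have "charpoly_on I \<Lambda> = det (mat 1 :: complex poly ^ 'n ^ 'n)"
      unfolding charpoly_on_def mat_def True by simp
    then show ?thesis by simp
  next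
    case False
    then have "card I > 0" by (simp add: card_gt_0_iff)
    then have "size (eigenvalues_on I \<Lambda>) > 0" using assms(4,6,8) by simp
    then show ?thesis by (auto simp: eigenvalues_on_def)
  qed
  obtain k where k: "k > 0" "\<And>x. norm (((*v) \<Lambda> ^^ k) x) \<le> norm x / 2"
    using block_matrix_power_contracts[OF assms(7) nz] assms(8) by auto
  have proj: "coord_proj I x = x" if "x \<in> coord_space I" for x
    using that by (simp add: coord_proj_def coord_space_def vec_eq_iff)
  obtain \<eta>\<^sub>0 where \<eta>\<^sub>0: "\<eta>\<^sub>0 > 0"
    and G: "\<And>x. x \<in> coord_space I \<Longrightarrow> norm x < \<eta>\<^sub>0 \<Longrightarrow> norm (G x) \<le> norm x"
  proof -
    have "coord_proj I 0 = (0 :: real ^ 'n)" by (intro proj) (simp add: coord_space_def)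
    then obtain \<eta> where "\<eta> > 0" "\<And>x. norm x < \<eta> \<Longrightarrow> norm (G (coord_proj I x)) \<le> norm x"
      using has_derivative_0_imp_small[OF assms(17), of 1] \<open>G 0 = 0\<close> by auto
    then show ?thesis using that proj by metis
  qed
  \<comment> \<open>On the graph the argument of \<open>F\<^sub>2\<close> has norm at most
    \<open>2 * norm x\<close>, hence the constant \<open>\<delta> / 2\<close> below.\<close>
  have small: "\<exists>\<eta>>0. \<forall>x\<in>coord_space I. norm x < \<eta> \<longrightarrow> norm (F\<^sub>2 (x + G x)) \<le> \<delta> * norm x"
    if "\<delta> > 0" for \<delta>
  proof -
    obtain \<eta> where \<eta>: "\<eta> > 0" "\<And>z. norm z < \<eta> \<Longrightarrow> norm (F\<^sub>2 z) \<le> \<delta> / 2 * norm z"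
      using has_derivative_0_imp_small[OF assms(13,12), of "\<delta> / 2"] \<open>\<delta> > 0\<close> by auto
    have "norm (F\<^sub>2 (x + G x)) \<le> \<delta> * norm x"
      if x: "x \<in> coord_space I" "norm x < min \<eta>\<^sub>0 (\<eta> / 2)" for x
    proof -
      have le: "norm (x + G x) \<le> 2 * norm x" using G[of x] x norm_triangle_ineq[of x "G x"] by simp
      then have "norm (F\<^sub>2 (x + G x)) \<le> \<delta> / 2 * norm (x + G x)" using \<eta>(2) x by simp
      also have "\<dots> \<le> \<delta> / 2 * (2 * norm x)" using le \<open>\<delta> > 0\<close> by (intro mult_left_mono) auto
      finally show ?thesis by simp
    qed
    then show ?thesis using \<eta>(1) \<eta>\<^sub>0 by (intro exI[of _ "min \<eta>\<^sub>0 (\<eta> / 2)"]) auto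
  qed
  obtain \<rho> where \<rho>: "\<rho> > 0" and decay: "\<forall>x. (\<forall>n. x n \<in> coord_space I \<and>
      x (Suc n) = \<Lambda> *v x n + F\<^sub>2 (x n + G (x n))) \<and> norm (x 0) < \<rho> \<longrightarrow>
      (\<forall>n. norm (x n) < \<eta>\<^sub>0) \<and> exp_decaying x"
    using linearized_orbit_exp_decay[OF k small \<eta>\<^sub>0] by blast
  show ?thesis
  proof (intro exI[of _ \<rho>] conjI allI impI \<rho>; elim conjE)
    fix X Y :: "nat \<Rightarrow> real ^ 'n"
    assume XY: "\<forall>n\<ge>1. X n \<in> coord_space I \<and> Y n = G (X n)"
      and X: "\<forall>n\<ge>1. X (Suc n) = \<Lambda> *v X n + F\<^sub>2 (X n + G (X n))"
      and start: "norm (X 1 + Y 1) < \<rho>"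
    \<comment> \<open>\<open>X 1\<close> and \<open>Y 1\<close> have disjoint supports, so smallness
      of the initial point passes to its first component.\<close>
    have "norm (X 1) \<le> norm (X 1 + Y 1)"
    proof (rule norm_le_componentwise_cart)
      fix i
      have "X 1 $ i = 0 \<or> Y 1 $ i = 0"
      proof -
        have "X 1 \<in> coord_space I" "Y 1 \<in> coord_space (- I)" using XY assms(14) by auto
        then show ?thesis by (cases "i \<in> I") (simp_all add: coord_space_def)
      qed
      then show "norm (X 1 $ i) \<le> norm ((X 1 + Y 1) $ i)" by auto
    qed
    \<comment> \<open>The orbit is indexed from 1 and \<open>decay\<close> from 0, hence the shift.
      Staying below \<open>\<eta>\<^sub>0\<close> is what later bounds \<open>Y\<close> by
      \<open>X\<close> along the whole orbit.\<close>
    then have "(\<forall>n. norm (X (Suc n)) < \<eta>\<^sub>0) \<and> exp_decaying (\<lambda>n. X (Suc n))"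
      using start XY X by (intro decay[rule_format]) auto
    then obtain C p where le: "\<And>n. norm (X (Suc n)) < \<eta>\<^sub>0" "\<And>n. norm (X (Suc n)) \<le> C * p ^ n"
      and p: "0 < p" "p < 1"
      unfolding exp_decaying_def by blast
    have "norm (X (Suc n) + Y (Suc n)) \<le> 2 * C * p ^ n" for n
    proof -
      have "norm (Y (Suc n)) \<le> norm (X (Suc n))" using XY G le(1) by simp
      then show ?thesis using le(2)[of n] norm_triangle_ineq[of "X (Suc n)" "Y (Suc n)"] by linarith
    qed
    then have "exp_decaying (\<lambda>n. X (Suc n) + Y (Suc n))"
      using p unfolding exp_decaying_def by blast
    then have "has_box_dim (range (\<lambda>n. X (Suc n) + Y (Suc n))) 0"
      by (rule has_box_dim_0_if_exp_decaying)
    moreover have "{X n + Y n | n. n \<ge> 1} = range (\<lambda>n. X (Suc n) + Y (Suc n))"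
      by (force simp: image_iff dest: Suc_le_D)
    ultimately show "has_box_dim {X n + Y n | n. n \<ge> 1} 0" by simp
  qed
qed

end
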